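(* Let $m,n$ be positive integers with $m$ even, let $A$ and $B$ be $m\times n$ matrices, and let $X$ be an $n\times n$ matrix. Then $$\operatorname{Pf}(AXB^t-BX^tA^t)=(-1)^{\binom{m/2}{2}}\sum_{\substack{I,J\subseteq[n]\\ |I|=|J|=m/2}}\det (X_{I,J})\,\det(A^IB^J).$$
   Context: All matrices have entries in a commutative ring with unit. $[n]=\{1,\dots,n\}$. $X_{I,J}$ is the submatrix of $X$ consisting of the rows indexed by $I$ and columns indexed by $J$ (in increasing order). $A^I$ is the submatrix of $A$ consisting of the columns indexed by $I$ (in increasing order), similarly $B^J$. $A^IB^J$ denotes the concatenation (side by side, $A^I$ first) of $A^I$ and $B^J$, an $m\times m$ matrix; it is not a matrix product. For a skew-symmetric matrix $Y$ of even size $m$ (with zero diagonal), the Pfaffian is $\operatorname{Pf}(Y)=\sum_{\mu}\operatorname{sgn}\mu\prod_{\{i,j\}\in\mu,\ i<j}Y_{i,j}$, the sum being over all perfect matchings $\mu$ of $[m]$, where $\operatorname{sgn}\mu=(-1)^{\mathrm{cr}(\mu)}$ and $\mathrm{cr}(\mu)$ is the number of quadruples $i<j<k<l$ such that $\{i,k\}$ and $\{j,l\}$ are pairs in $\mu$. *)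

theory Defs
  imports
    "Jordan_Normal_Form.Determinant"
    "Jordan_Normal_Form.DL_Submatrix"
    "HOL-Library.Disjoint_Sets"
begin

text \<open>Matrices are indexed from 0, so a set of row or column indices is a subset of
  \<open>{0..<n}\<close> rather than of \<open>{1..n}\<close>.\<close>

text \<open>\<open>pick I\<close>, used by \<^const>\<open>submatrix\<close>, enumerates \<open>I\<close> increasingly, and \<open>pick UNIV\<close> is the
  identity; the row index set \<open>UNIV\<close> therefore keeps every row.\<close>

definition cols_submatrix :: "'a mat \<Rightarrow> nat set \<Rightarrow> 'a mat" where
  "cols_submatrix A I = submatrix A UNIV I"

definition append_cols :: "'a :: zero mat \<Rightarrow> 'a mat \<Rightarrow> 'a mat" (infixr "@\<^sub>c" 65) where
  "A @\<^sub>c B = four_block_mat A B (0\<^sub>m 0 (dim_col A)) (0\<^sub>m 0 (dim_col B))"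

definition perfect_matchings :: "nat \<Rightarrow> nat set set set" where
  "perfect_matchings m = {M. partition_on {0..<m} M \<and> (\<forall>e\<in>M. card e = 2)}"

definition crossings :: "nat set set \<Rightarrow> nat" where
  "crossings M =
    card {(i, j, k, l). i < j \<and> j < k \<and> k < l \<and> {i, k} \<in> M \<and> {j, l} \<in> M}"

text \<open>The Pfaffian is meant for square matrices of even size with \<open>Y\<^sup>t = - Y\<close> and zero diagonal;
  the formula reads only the entries above the diagonal. A pair \<open>{i, j}\<close> with \<open>i < j\<close>
  contributes the entry at \<open>i = Min {i, j}\<close>, \<open>j = Max {i, j}\<close>.\<close>

definition pfaffian :: "'a :: comm_ring_1 mat \<Rightarrow> 'a" where
  "pfaffian Y =
    (\<Sum>M\<in>perfect_matchings (dim_row Y). (- 1) ^ crossings M * (\<Prod>e\<in>M. Y $$ (Min e, Max e)))"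

end

theory Submission
  imports Defs
begin

text \<open>Write \<open>m = 2 k\<close>. The matrix on the left is \<open>Z - Z\<^sup>t\<close> with \<open>Z = A C\<^sup>t\<close> and \<open>C = B X\<^sup>t\<close>. Multiplying
  out the Pfaffian of \<open>Z - Z\<^sup>t\<close> over each matching chooses a direction for every edge. A directed
  perfect matching is the same thing as a permutation \<open>p\<close> of the \<open>2 k\<close> points, edge \<open>r\<close> going from
  \<open>p r\<close> to \<open>p (k + r)\<close>, once the edges are numbered so that their tails increase. The sign of such a
  \<open>p\<close> is, up to the constant \<open>(-1)\<close> to the power \<open>k choose 2\<close>, the crossing sign of the matching
  times \<open>- 1\<close> for each edge directed from its larger to its smaller end (\<open>sign_matching_of\<close>). So the Pfaffian is a
  signed sum of \<open>\<Prod>r<k. Z (p r) (p (k + r))\<close> over the permutations with increasing tails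
  (\<open>pfaffian_skew_part\<close>).

  Expanding \<open>Z = A C\<^sup>t\<close> in turn attaches to each edge a column \<open>g r\<close>. If two edges carry the same
  column, exchanging their heads reverses the sign and keeps the product, so only injective \<open>g\<close>
  survive. An injective \<open>g\<close> is a \<open>k\<close>-set \<open>I\<close> of columns together with a permutation \<open>\<sigma>\<close> of the
  edges, and renumbering the edges by \<open>\<sigma>\<close> permutes tails and heads alike, which is an even
  permutation. The ordering thus moves from the tails to the columns: the sum over increasing tails
  and arbitrary injective columns becomes a sum over arbitrary permutations and increasing columns,
  that is, over the determinants of \<open>A\<^sup>I C\<^sup>I\<close> (\<open>sum_sorted_perms_cauchy_binet\<close>).

  The same cancellation, now applied to the expansion of \<open>C = B X\<^sup>t\<close> inside \<open>det (A\<^sup>I C\<^sup>I)\<close>, turns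
  this determinant into the sum over \<open>J\<close> of \<open>det X\<^bsub>I,J\<^esub> det (A\<^sup>I B\<^sup>J)\<close> (\<open>sum_perms_cauchy_binet\<close>).

  Every cancellation pairs terms off and every regrouping is a bijection, so no division
  occurs and the argument is valid over any commutative ring.\<close>

section \<open>The sign of a permutation as a product over pairs\<close>

definition order_sign :: "nat \<Rightarrow> nat \<Rightarrow> int" where
  "order_sign x y = (if x < y then 1 else - 1)"

abbreviation index_pairs :: "nat \<Rightarrow> (nat \<times> nat) set" where
  "index_pairs m \<equiv> {(i, j). i < j \<and> j < m}"

definition inversion_sign :: "nat \<Rightarrow> (nat \<Rightarrow> nat) \<Rightarrow> int" where
  "inversion_sign m p = (\<Prod>(i, j)\<in>index_pairs m. order_sign (p i) (p j))"

lemma finite_index_pairs [simp]: "finite (index_pairs m)"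
  by (rule finite_subset[of _ "{..<m} \<times> {..<m}"]) auto

lemma inversion_sign_square: "inversion_sign m p * inversion_sign m p = 1"
  unfolding inversion_sign_def prod.distrib[symmetric]
  by (rule prod.neutral) (auto simp: order_sign_def)

text \<open>The quotient of the factors of \<open>p \<circ> q\<close> and of \<open>q\<close> at a pair \<open>(i, j)\<close> depends only on the
  unordered pair \<open>{q i, q j}\<close>, and these run once through all unordered pairs. Since signs are their
  own inverses, the quotient is written below as a product.\<close>

lemma inversion_sign_compose:
  assumes p: "p permutes {0..<m}" and q: "q permutes {0..<m}"
  shows "inversion_sign m (p \<circ> q) = inversion_sign m p * inversion_sign m q"
proof -
  define h where "h = (\<lambda>(x, y). order_sign (p x) (p y) * order_sign x y)"
  define sort where "sort = (\<lambda>(x, y). (min x y, max x y) :: nat \<times> nat)"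
  have h_sym: "h (x, y) = h (y, x)" for x y
    using permutes_inj[OF p] by (cases "x = y") (auto simp: h_def order_sign_def inj_def)
  have q_lt: "q i < m \<longleftrightarrow> i < m" for i
    using permutes_in_image[OF q, of i] by simp
  have q_inj: "q i = q j \<longleftrightarrow> i = j" for i j
    using permutes_inj[OF q] by (auto simp: inj_def)
  have inj: "inj_on (\<lambda>(i, j). sort (q i, q j)) (index_pairs m)"
    by (auto simp: inj_on_def sort_def min_def max_def q_inj split: if_splits)
  have "(\<lambda>(i, j). sort (q i, q j)) ` index_pairs m \<subseteq> index_pairs m"
    by (auto simp: sort_def q_lt q_inj less_max_iff_disj min_less_iff_disj nat_neq_iff[symmetric])
  then have img: "(\<lambda>(i, j). sort (q i, q j)) ` index_pairs m = index_pairs m"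
    by (intro endo_inj_surj inj) auto
  have "prod h (index_pairs m) = prod h ((\<lambda>(i, j). sort (q i, q j)) ` index_pairs m)"
    by (simp only: img)
  also have "\<dots> = (\<Prod>(i, j)\<in>index_pairs m. h (sort (q i, q j)))"
    by (subst prod.reindex[OF inj]) (simp add: case_prod_unfold comp_def)
  also have "\<dots> = (\<Prod>(i, j)\<in>index_pairs m. h (q i, q j))"
    by (intro prod.cong) (auto simp: sort_def min_def max_def h_sym)
  also have "\<dots> = inversion_sign m (p \<circ> q) * inversion_sign m q"
    unfolding inversion_sign_def prod.distrib[symmetric]
    by (intro prod.cong) (auto simp: h_def)
  finally have "prod h (index_pairs m) = inversion_sign m (p \<circ> q) * inversion_sign m q" .
  moreover have "prod h (index_pairs m) = inversion_sign m p"
    unfolding inversion_sign_def by (intro prod.cong) (auto simp: h_def order_sign_def)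
  ultimately show ?thesis
    using inversion_sign_square[of m q] by (metis mult.assoc mult.right_neutral)
qed

lemma inversion_sign_transpose:
  assumes "a < b" "b < m"
  shows "inversion_sign m (Transposition.transpose a b) = - 1"
proof -
  let ?t = "Transposition.transpose a b"
  let ?inv = "insert (a, b) (Pair a ` {a<..<b} \<union> (\<lambda>i. (i, b)) ` {a<..<b})"
  \<comment> \<open>The set \<open>?inv\<close> lists the inversions of the transposition: the pair \<open>(a, b)\<close> itself and, for each
  position strictly between, one pair with either end.\<close>
  have "inversion_sign m ?t = (\<Prod>(i, j)\<in>?inv. order_sign (?t i) (?t j))"
    unfolding inversion_sign_def
    by (rule prod.mono_neutral_right)
      (use assms in \<open>auto simp: order_sign_def Transposition.transpose_def split: if_splits\<close>)
  also have "\<dots> = (\<Prod>x\<in>?inv. - 1)"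
    using assms
    by (intro prod.cong) (auto simp: order_sign_def Transposition.transpose_def split: if_splits)
  also have "\<dots> = (- 1) ^ card ?inv"
    by simp
  also have "card ?inv = Suc (card {a<..<b} + card {a<..<b})"
    by (subst card_insert_disjoint, simp, force, subst card_Un_disjoint)
      (auto simp: card_image inj_on_def)
  finally show ?thesis by (simp add: power_add[symmetric] mult_2[symmetric])
qed

lemma sign_eq_inversion_sign:
  assumes "p permutes {0..<m}"
  shows "sign p = inversion_sign m p"
  using assms finite_atLeastLessThan
proof (induction rule: permutes_induct)
  case id
  then show ?case
    unfolding inversion_sign_def
    by (subst prod.neutral) (auto simp: order_sign_def)
next
  case (swap a b p)
  have t: "Transposition.transpose a b permutes {0..<m}"
    using swap by (simp add: permutes_swap_id)
  have "inversion_sign m (Transposition.transpose a b) = - 1"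
    using inversion_sign_transpose[of a b m] inversion_sign_transpose[of b a m] swap
    by (cases "a < b") (auto simp: transpose_commute)
  moreover have "sign (Transposition.transpose a b \<circ> p) = - sign p"
    using swap t by (subst sign_compose) (auto simp: sign_swap_id permutation_permutes)
  ultimately show ?case
    using swap by (simp only: inversion_sign_compose[OF t])
qed

section \<open>The sign of a permutation and the crossings of its matching\<close>

text \<open>The chords \<open>{a, b}\<close> and \<open>{c, d}\<close> enter asymmetrically: only a crossing in which \<open>{a, b}\<close> starts
  first is counted. Summed over ordered pairs of edges this counts each crossing once.\<close>

definition crossing_sign :: "nat \<Rightarrow> nat \<Rightarrow> nat \<Rightarrow> nat \<Rightarrow> int" where
  "crossing_sign a b c d =
    (if min a b < min c d \<and> min c d < max a b \<and> max a b < max c d then - 1 else 1)"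

text \<open>In the list \<open>a, b, c, d\<close> the number of inversions between the edges \<open>{a, b}\<close> and \<open>{c, d}\<close> is odd
  exactly if they cross. Here the positions are those of \<open>a, c, b, d\<close>, tails before heads; this exchanges
  the comparison of \<open>b\<close> and \<open>c\<close> and gives the extra minus sign, hence ultimately the factor
  \<open>(-1)\<close> to the power \<open>k choose 2\<close>.\<close>

lemma crossing_sign_eq_order_signs:
  assumes "distinct [a, b, c, d]"
  shows "order_sign a c * order_sign a d * order_sign c b * order_sign b d =
    - (crossing_sign a b c d * crossing_sign c d a b)"
proof -
  have *: "order_sign a c * order_sign a d * order_sign c b * order_sign b d =
    - (crossing_sign a b c d * crossing_sign c d a b)" if "a < b" "c < d" "b \<noteq> c" "a \<noteq> c" "b \<noteq> d" "a \<noteq> d" for a b c d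
  proof -
    have "min a b = a" "max a b = b" "min c d = c" "max c d = d" using that by auto
    then show ?thesis
    using that unfolding crossing_sign_def
    by (cases "a < c"; cases "a < d"; cases "b < c"; cases "b < d") (simp_all add: order_sign_def)
  qed
  have flip: "order_sign x y = - order_sign y x" if "x \<noteq> y" for x y
    using that by (auto simp: order_sign_def)
  have csym: "crossing_sign b a = crossing_sign a b" "crossing_sign x y b a = crossing_sign x y a b" for a b x y
    by (auto simp: crossing_sign_def min.commute max.commute fun_eq_iff)
  have "a < b \<or> b < a" "c < d \<or> d < c" using assms by auto
  then show ?thesis
    using *[of a b c d] *[of b a c d] *[of a b d c] *[of b a d c] assms
      flip[of a c] flip[of a d] flip[of b c] flip[of b d] by (auto simp: csym mult_ac)
qed
text \<open>A permutation of \<open>{0..<2 * k}\<close> is read as a numbered list of \<open>k\<close> directed edges: the first \<open>k\<close>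
  values are the tails and the last \<open>k\<close> values the heads. This layout matches the columns of
  \<open>A\<^sup>I B\<^sup>J\<close>.\<close>

definition matching_of :: "nat \<Rightarrow> (nat \<Rightarrow> nat) \<Rightarrow> nat set set" where
  "matching_of k p = (\<lambda>r. {p r, p (k + r)}) ` {..<k}"

lemma card_index_pairs: "card (index_pairs k) = k choose 2"
proof (induction k)
  case (Suc k)
  have "index_pairs (Suc k) = index_pairs k \<union> (\<lambda>i. (i, k)) ` {..<k}"
    by (auto simp: less_Suc_eq)
  then have "card (index_pairs (Suc k)) = card (index_pairs k) + card ((\<lambda>i. (i, k)) ` {..<k})"
    by (simp only:, subst card_Un_disjoint) auto
  also have "card ((\<lambda>i. (i, k)) ` {..<k}) = k"
    by (simp add: card_image inj_on_def)
  finally show ?case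
    using Suc by (simp add: numeral_2_eq_2)
qed (simp add: binomial_eq_0)

text \<open>A pair of positions in \<open>{0..<2 * k}\<close> belongs either to one edge or to two edges \<open>r < s\<close>; in the
  latter case there are four such pairs. Note the pair \<open>(s, k + r)\<close>: the tail of \<open>s\<close> precedes the
  head of \<open>r\<close>.\<close>

lemma prod_index_pairs_double:
  fixes f :: "nat \<times> nat \<Rightarrow> 'a :: comm_monoid_mult"
  shows "prod f (index_pairs (2 * k)) = (\<Prod>r<k. f (r, k + r)) *
    (\<Prod>(r, s)\<in>index_pairs k. f (r, s) * f (r, k + s) * f (s, k + r) * f (k + r, k + s))"
proof -
  let ?T = "index_pairs k"
  let ?P1 = "(\<lambda>r. (r, k + r)) ` {..<k}"
  let ?P2 = "(\<lambda>(r, s). (r, k + s)) ` ?T"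
  let ?P3 = "(\<lambda>(r, s). (s, k + r)) ` ?T"
  let ?P4 = "(\<lambda>(r, s). (k + r, k + s)) ` ?T"
  have "index_pairs (2 * k) \<subseteq> ?P1 \<union> (?T \<union> (?P2 \<union> (?P3 \<union> ?P4)))"
  proof
    fix x assume "x \<in> index_pairs (2 * k)"
    then obtain i j where x: "x = (i, j)" and ij: "i < j" "j < 2 * k" by blast
    consider "j < k" | "k \<le> i" | "i < k" "j = k + (j - k)" "j - k < k"
      using ij by linarith
    then have "(i, j) \<in> ?P1 \<union> (?T \<union> (?P2 \<union> (?P3 \<union> ?P4)))"
    proof cases
      case 2
      then have "(i, j) = (\<lambda>(r, s). (k + r, k + s)) (i - k, j - k)" "(i - k, j - k) \<in> ?T"
        using ij by auto
      then show ?thesis by blast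
    next
      case 3
      show ?thesis
      proof (cases rule: linorder_cases[of i "j - k"])
        case less
        then have "(i, j) = (\<lambda>(r, s). (r, k + s)) (i, j - k)" "(i, j - k) \<in> ?T"
          using 3 by auto
        then show ?thesis by blast
      next
        case equal
        with 3 show ?thesis by auto
      next
        case greater
        then have "(i, j) = (\<lambda>(r, s). (s, k + r)) (j - k, i)" "(j - k, i) \<in> ?T"
          using 3 by auto
        then show ?thesis by blast
      qed
    qed (use ij in auto)
    then show "x \<in> ?P1 \<union> (?T \<union> (?P2 \<union> (?P3 \<union> ?P4)))"
      by (simp only: x)
  qed
  then have split: "index_pairs (2 * k) = ?P1 \<union> (?T \<union> (?P2 \<union> (?P3 \<union> ?P4)))"
    by auto
  have "prod f (index_pairs (2 * k)) = prod f ?P1 * (prod f ?T * (prod f ?P2 * (prod f ?P3 * prod f ?P4)))"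
    unfolding split
    apply (subst prod.union_disjoint, simp, simp, force)
    apply (subst prod.union_disjoint, simp, simp, force)
    apply (subst prod.union_disjoint, simp, simp, force)
    apply (subst prod.union_disjoint, simp, simp, force)
    by (rule refl)
  also have "prod f ?P1 = (\<Prod>r<k. f (r, k + r))"
    by (subst prod.reindex) (auto simp: inj_on_def)
  also have "prod f ?P2 = (\<Prod>(r, s)\<in>?T. f (r, k + s))"
    by (subst prod.reindex) (auto simp: inj_on_def case_prod_unfold)
  also have "prod f ?P3 = (\<Prod>(r, s)\<in>?T. f (s, k + r))"
    by (subst prod.reindex) (auto simp: inj_on_def case_prod_unfold)
  also have "prod f ?P4 = (\<Prod>(r, s)\<in>?T. f (k + r, k + s))"
    by (subst prod.reindex) (auto simp: inj_on_def case_prod_unfold)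
  finally show ?thesis
    by (simp add: prod.distrib case_prod_unfold mult_ac)
qed

lemma prod_square_conv_index_pairs:
  fixes f :: "nat \<times> nat \<Rightarrow> 'a :: comm_monoid_mult"
  assumes "\<And>r. f (r, r) = 1"
  shows "prod f ({..<k} \<times> {..<k}) = (\<Prod>(r, s)\<in>index_pairs k. f (r, s) * f (s, r))"
proof -
  let ?D = "(\<lambda>r. (r, r)) ` {..<k}" and ?U = "(\<lambda>(r, s). (s, r)) ` index_pairs k"
  have "(a, b) \<in> {..<k} \<times> {..<k} \<longleftrightarrow> (a, b) \<in> ?D \<union> (index_pairs k \<union> ?U)" for a b
    by (cases rule: linorder_cases[of a b]) (auto simp: image_iff)
  then have "{..<k} \<times> {..<k} = ?D \<union> (index_pairs k \<union> ?U)"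
    unfolding set_eq_iff split_paired_All by (intro allI)
  then have "prod f ({..<k} \<times> {..<k}) = prod f (?D \<union> (index_pairs k \<union> ?U))"
    by simp
  also have "\<dots> = prod f ?D * (prod f (index_pairs k) * prod f ?U)"
    by (subst prod.union_disjoint, simp, simp, force, subst prod.union_disjoint) auto
  also have "prod f ?D = 1"
    using assms by (intro prod.neutral) auto
  also have "prod f ?U = (\<Prod>(r, s)\<in>index_pairs k. f (s, r))"
    by (subst prod.reindex) (auto simp: inj_on_def case_prod_unfold)
  finally show ?thesis
    by (simp add: prod.distrib case_prod_unfold)
qed

lemma endpoints_distinct:
  fixes p :: "nat \<Rightarrow> nat"
  assumes "p permutes {0..<2 * k}" "r < k" "s < k" "r \<noteq> s"
  shows "distinct [p r, p (k + r), p s, p (k + s)]"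
  using assms(2-) by (simp add: inj_eq[OF permutes_inj[OF assms(1)]])

text \<open>A crossing quadruple determines its two edges, and the edge containing the smallest point comes
  first; so quadruples correspond to ordered pairs of edge numbers with crossing sign \<open>- 1\<close>.\<close>

lemma crossings_matching_of:
  assumes p: "p permutes {0..<2 * k}"
  shows "(- 1) ^ crossings (matching_of k p) =
    (\<Prod>(r, s)\<in>{..<k} \<times> {..<k}. crossing_sign (p r) (p (k + r)) (p s) (p (k + s)))"
proof -
  define lo hi where "lo r = min (p r) (p (k + r))" and "hi r = max (p r) (p (k + r))" for r
  define Q where "Q = {(r, s). r < k \<and> s < k \<and> lo r < lo s \<and> lo s < hi r \<and> hi r < hi s}"
  define g where "g = (\<lambda>(r, s). (lo r, lo s, hi r, hi s))"
  have Q: "Q \<subseteq> {..<k} \<times> {..<k}" by (auto simp: Q_def)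
  have lo_eq: "lo r = lo s \<longleftrightarrow> r = s" if "r < k" "s < k" for r s
    using endpoints_distinct[OF p that] by (auto simp: lo_def min_def split: if_splits)
  have pair: "{i, j} \<in> matching_of k p \<longleftrightarrow> (\<exists>r<k. i = lo r \<and> j = hi r)" if "i < j" for i j
  proof -
    have "{i, j} = {p r, p (k + r)} \<longleftrightarrow> i = lo r \<and> j = hi r" for r
      using that by (auto simp: lo_def hi_def doubleton_eq_iff min_def max_def)
    then show ?thesis by (auto simp: matching_of_def image_iff)
  qed
  have "{(i, j, l, m). i < j \<and> j < l \<and> l < m \<and> {i, l} \<in> matching_of k p \<and> {j, m} \<in> matching_of k p}
      = {(i, j, l, m). i < j \<and> j < l \<and> l < m \<and>
          (\<exists>r<k. i = lo r \<and> l = hi r) \<and> (\<exists>r<k. j = lo r \<and> m = hi r)}"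
    using pair by (auto dest: less_trans)
  also have "\<dots> = g ` Q"
    by (auto simp: g_def Q_def image_iff)
  finally have "crossings (matching_of k p) = card (g ` Q)"
    unfolding crossings_def by simp
  also have "\<dots> = card Q"
    by (rule card_image) (auto simp: inj_on_def g_def Q_def lo_eq)
  finally have "(- 1) ^ crossings (matching_of k p) = (\<Prod>x\<in>Q. - 1 :: int)"
    by simp
  also have "\<dots> = (\<Prod>(r, s)\<in>{..<k} \<times> {..<k}. crossing_sign (p r) (p (k + r)) (p s) (p (k + s)))"
  proof (rule prod.mono_neutral_cong_left)
    show "\<forall>x\<in>{..<k} \<times> {..<k} - Q.
        (case x of (r, s) \<Rightarrow> crossing_sign (p r) (p (k + r)) (p s) (p (k + s))) = 1"
      unfolding crossing_sign_def lo_def[symmetric] hi_def[symmetric] Q_def by (auto split: if_splits)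
    show "- 1 = (case x of (r, s) \<Rightarrow> crossing_sign (p r) (p (k + r)) (p s) (p (k + s)))"
      if "x \<in> Q" for x
      using that unfolding crossing_sign_def lo_def[symmetric] hi_def[symmetric] Q_def by (auto split: if_splits)
  qed (use Q in auto)
  finally show ?thesis .
qed

text \<open>Split the inversion product into the pairs within an edge, which record the directions, and the
  pairs between two edges, which record the crossings up to one factor \<open>- 1\<close> for each of the
  \<open>k choose 2\<close> pairs of edges.\<close>

lemma sign_matching_of:
  assumes p: "p permutes {0..<2 * k}"
  shows "sign p = (- 1) ^ (k choose 2) * (- 1) ^ crossings (matching_of k p) *
    (\<Prod>r<k. order_sign (p r) (p (k + r)))"
proof -
  let ?c = "\<lambda>(r, s). crossing_sign (p r) (p (k + r)) (p s) (p (k + s))"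
  let ?cc = "\<lambda>(r, s). ?c (r, s) * ?c (s, r)"
  have "sign p = (\<Prod>r<k. order_sign (p r) (p (k + r))) *
      (\<Prod>(r, s)\<in>index_pairs k. order_sign (p r) (p s) * order_sign (p r) (p (k + s)) *
        order_sign (p s) (p (k + r)) * order_sign (p (k + r)) (p (k + s)))"
    unfolding sign_eq_inversion_sign[OF p] inversion_sign_def
    by (simp add: prod_index_pairs_double)
  also have "(\<Prod>(r, s)\<in>index_pairs k. order_sign (p r) (p s) * order_sign (p r) (p (k + s)) *
        order_sign (p s) (p (k + r)) * order_sign (p (k + r)) (p (k + s)))
      = (\<Prod>x\<in>index_pairs k. - 1 * ?cc x)"
  proof (rule prod.cong[OF refl])
    fix x assume "x \<in> index_pairs k"
    then obtain r s where x: "x = (r, s)" "r < s" "s < k" by blast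
    then show "(case x of (r, s) \<Rightarrow> order_sign (p r) (p s) * order_sign (p r) (p (k + s)) *
        order_sign (p s) (p (k + r)) * order_sign (p (k + r)) (p (k + s))) = - 1 * ?cc x"
      using crossing_sign_eq_order_signs[OF endpoints_distinct[OF p, of r s]] by simp
  qed
  also have "\<dots> = (- 1) ^ (k choose 2) * (\<Prod>x\<in>index_pairs k. ?cc x)"
    by (subst prod.distrib) (simp add: card_index_pairs)
  also have "(\<Prod>x\<in>index_pairs k. ?cc x) = (- 1) ^ crossings (matching_of k p)"
    unfolding crossings_matching_of[OF p]
    by (subst prod_square_conv_index_pairs) (auto simp: crossing_sign_def)
  finally show ?thesis by (simp add: mult_ac)
qed

section \<open>Sorting functions and permutations\<close>

lemma pick_bij_betw:
  assumes "finite I" "card I = k"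
  shows "bij_betw (pick I) {..<k} I"
proof -
  have "inj_on (pick I) {..<k}"
    using assms pick_mono_le[of _ I] by (intro linorder_inj_onI) (auto, metis nat_neq_iff)
  moreover have "pick I ` {..<k} \<subseteq> I"
    using assms pick_in_set_le by auto
  ultimately show ?thesis
    using assms card_subset_eq[of I "pick I ` {..<k}"] by (simp add: bij_betw_def card_image)
qed

text \<open>A strictly increasing function is determined by its image, as the enumeration \<open>pick\<close> of that image.\<close>

lemma strict_mono_on_eq_pick:
  assumes f: "strict_mono_on {..<k} f" and r: "r < k"
  shows "f r = pick (f ` {..<k}) r"
proof -
  have less: "f s < f r \<longleftrightarrow> s < r" if "s < k" for s
    using strict_mono_on_less[OF f, of s r] that r by simp
  have inj: "inj_on f {..<k}"
    using f by (rule strict_mono_on_imp_inj_on)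
  have "{a \<in> f ` {..<k}. a < f r} = f ` {..<r}"
    using r less by auto
  moreover have "card (f ` {..<r}) = r"
    using r by (subst card_image) (auto intro: inj_on_subset[OF inj])
  ultimately show ?thesis
    using pick_card_in_set[of "f r" "f ` {..<k}"] r by auto
qed

lemma obtain_sorting_permutation:
  assumes q: "inj_on q {..<k}"
  obtains \<sigma> where "\<sigma> permutes {0..<k}" "\<And>r. r < k \<Longrightarrow> q r = pick (q ` {..<k}) (\<sigma> r)"
proof -
  let ?I = "q ` {..<k}"
  let ?s = "\<lambda>r. inv_into {..<k} (pick ?I) (q r)"
  define \<sigma> where "\<sigma> r = (if r < k then ?s r else r)" for r
  have pick: "bij_betw (pick ?I) {..<k} ?I"
    using q by (intro pick_bij_betw) (auto simp: card_image)
  have "bij_betw (inv_into {..<k} (pick ?I) \<circ> q) {..<k} {..<k}"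
    using q by (intro bij_betw_trans[OF _ bij_betw_inv_into[OF pick]]) (simp add: bij_betw_def)
  then have "bij_betw \<sigma> {..<k} {..<k}"
    by (rule iffD1[OF bij_betw_cong, rotated]) (simp add: \<sigma>_def)
  then have "\<sigma> permutes {0..<k}"
    by (intro bij_imp_permutes) (auto simp: \<sigma>_def atLeast0LessThan)
  moreover have "q r = pick ?I (\<sigma> r)" if "r < k" for r
    using that pick by (simp add: \<sigma>_def bij_betw_def f_inv_into_f)
  ultimately show ?thesis using that by blast
qed

text \<open>The functions that are not injective contribute \<open>0\<close>, and an injective one is the increasing
  enumeration of its image preceded by a unique permutation.\<close>

lemma sum_functions_by_image:
  fixes F :: "(nat \<Rightarrow> nat) \<Rightarrow> 'a :: comm_monoid_add"
  assumes cong: "\<And>g h. (\<And>r. r < k \<Longrightarrow> g r = h r) \<Longrightarrow> F g = F h"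
    and vanish: "\<And>g r s. r < k \<Longrightarrow> s < k \<Longrightarrow> r \<noteq> s \<Longrightarrow> g r = g s \<Longrightarrow> F g = 0"
  shows "(\<Sum>g\<in>{..<k} \<rightarrow>\<^sub>E {0..<n}. F g) =
    (\<Sum>I | I \<subseteq> {0..<n} \<and> card I = k. \<Sum>\<sigma> | \<sigma> permutes {0..<k}. F (\<lambda>r. pick I (\<sigma> r)))"
proof -
  let ?Is = "{I. I \<subseteq> {0..<n} \<and> card I = k}" and ?S = "{\<sigma>. \<sigma> permutes {0..<k}}"
  let ?G = "{g \<in> {..<k} \<rightarrow>\<^sub>E {0..<n}. inj_on g {..<k}}"
  let ?\<Phi> = "\<lambda>(I, \<sigma>). restrict (\<lambda>r. pick I (\<sigma> r)) {..<k}"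
  have finI: "finite I" if "I \<in> ?Is" for I
    using that finite_subset by blast
  have img: "?\<Phi> (I, \<sigma>) ` {..<k} = I" "inj_on (?\<Phi> (I, \<sigma>)) {..<k}"
    if "I \<in> ?Is" "\<sigma> \<in> ?S" for I \<sigma>
  proof -
    have "bij_betw (pick I \<circ> \<sigma>) {..<k} I"
      using that by (intro bij_betw_trans[OF _ pick_bij_betw[OF finI]])
        (auto intro: permutes_imp_bij simp: lessThan_atLeast0)
    then have "bij_betw (?\<Phi> (I, \<sigma>)) {..<k} I"
      by (rule iffD1[OF bij_betw_cong, rotated]) simp
    then show "?\<Phi> (I, \<sigma>) ` {..<k} = I" "inj_on (?\<Phi> (I, \<sigma>)) {..<k}"
      by (auto simp: bij_betw_def)
  qed
  have bij: "bij_betw ?\<Phi> (?Is \<times> ?S) ?G"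
    unfolding bij_betw_def
  proof (intro conjI inj_onI equalityI subsetI)
    fix x y assume x: "x \<in> ?Is \<times> ?S" and y: "y \<in> ?Is \<times> ?S" and eq: "?\<Phi> x = ?\<Phi> y"
    obtain I \<sigma> J \<tau> where xy: "x = (I, \<sigma>)" "y = (J, \<tau>)" by fastforce
    have I: "I \<in> ?Is" "J \<in> ?Is" "\<sigma> permutes {0..<k}" "\<tau> permutes {0..<k}"
      using x y xy by auto
    have "I = ?\<Phi> x ` {..<k}" "J = ?\<Phi> y ` {..<k}"
      unfolding xy by (rule img(1)[symmetric]; use I in simp)+
    then have IJ: "I = J"
      using eq by simp
    have "\<sigma> r = \<tau> r" for r
    proof (cases "r < k")
      case True
      then have "?\<Phi> x r = ?\<Phi> y r" using eq by simp
      then have "pick I (\<sigma> r) = pick I (\<tau> r)"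
        using True by (simp add: xy IJ)
      moreover have "\<sigma> r < k" "\<tau> r < k"
        using True permutes_in_image[OF I(3), of r] permutes_in_image[OF I(4), of r] by auto
      moreover have "inj_on (pick I) {..<k}"
        using pick_bij_betw[OF finI] I by (auto simp: bij_betw_def)
      ultimately show ?thesis by (simp add: inj_on_eq_iff)
    next
      case False
      then show ?thesis using I by (simp add: permutes_not_in)
    qed
    then show "x = y" using IJ by (auto simp: xy)
  next
    fix g assume "g \<in> ?\<Phi> ` (?Is \<times> ?S)"
    then obtain I \<sigma> where g: "g = ?\<Phi> (I, \<sigma>)" "I \<in> ?Is" "\<sigma> \<in> ?S" by auto
    then have "g r \<in> {0..<n}" if "r < k" for r
      using img(1)[OF g(2,3)] that by blast
    then show "g \<in> ?G"
      using img(2)[OF g(2,3)] g(1) by (auto simp: PiE_iff extensional_def)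
  next
    fix g assume g: "g \<in> ?G"
    obtain \<sigma> where \<sigma>: "\<sigma> permutes {0..<k}" "\<And>r. r < k \<Longrightarrow> g r = pick (g ` {..<k}) (\<sigma> r)"
      using g by (blast intro: obtain_sorting_permutation)
    have "?\<Phi> (g ` {..<k}, \<sigma>) = restrict g {..<k}"
      using \<sigma>(2) by (auto simp: restrict_def)
    also have "\<dots> = g"
      using g by (intro PiE_restrict[of g "{..<k}" "\<lambda>_. {0..<n}"]) simp
    finally have "g = ?\<Phi> (g ` {..<k}, \<sigma>)" ..
    moreover have "g ` {..<k} \<in> ?Is"
      using g by (auto simp: card_image PiE_iff)
    ultimately show "g \<in> ?\<Phi> ` (?Is \<times> ?S)"
      using \<sigma>(1) by blast
  qed
  have "(\<Sum>g\<in>{..<k} \<rightarrow>\<^sub>E {0..<n}. F g) = (\<Sum>g\<in>?G. F g)"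
    by (rule sum.mono_neutral_right) (auto simp: finite_PiE inj_on_def intro: vanish)
  also have "\<dots> = (\<Sum>x\<in>?Is \<times> ?S. F (?\<Phi> x))"
    by (rule sum.reindex_bij_betw[OF bij, symmetric])
  also have "\<dots> = (\<Sum>(I, \<sigma>)\<in>?Is \<times> ?S. F (\<lambda>r. pick I (\<sigma> r)))"
    by (intro sum.cong refl) (auto intro: cong)
  finally show ?thesis
    by (simp add: sum.cartesian_product)
qed

text \<open>One representative for each directed perfect matching: the edges are numbered by increasing tails.\<close>

definition sorted_perms :: "nat \<Rightarrow> (nat \<Rightarrow> nat) set" where
  "sorted_perms k = {p. p permutes {0..<2 * k} \<and> strict_mono_on {..<k} p}"

text \<open>Renumbering the edges by \<open>\<sigma>\<close> acts on positions by applying \<open>\<sigma>\<close> to the tail positions and, shifted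
  by \<open>k\<close>, to the head positions.\<close>

definition double_perm :: "nat \<Rightarrow> (nat \<Rightarrow> nat) \<Rightarrow> nat \<Rightarrow> nat" where
  "double_perm k \<sigma> i = (if i < k then \<sigma> i else if i < 2 * k then k + \<sigma> (i - k) else i)"

lemma
  assumes \<sigma>: "\<sigma> permutes {0..<k}"
  shows double_perm_permutes: "double_perm k \<sigma> permutes {0..<2 * k}"
    and sign_double_perm: "sign (double_perm k \<sigma>) = 1"
proof -
  \<comment> \<open>\<open>\<rho>\<close> exchanges the two halves, so \<open>double_perm k \<sigma>\<close> is \<open>\<sigma>\<close> times its conjugate by \<open>\<rho>\<close>; conjugates
  have equal signs.\<close>
  define \<rho> where "\<rho> i = (if i < k then i + k else if i < 2 * k then i - k else i)" for i
  have "bij_betw \<rho> {0..<2 * k} {0..<2 * k}"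
    by (rule bij_betw_byWitness[of _ \<rho>]) (auto simp: \<rho>_def)
  then have \<rho>: "\<rho> permutes {0..<2 * k}"
    by (rule bij_imp_permutes) (auto simp: \<rho>_def)
  have \<sigma>': "\<sigma> permutes {0..<2 * k}"
    using \<sigma> by (rule permutes_subset) auto
  have lt: "\<sigma> i < k \<longleftrightarrow> i < k" for i
    using permutes_in_image[OF \<sigma>, of i] by simp
  have fix_\<sigma>: "\<sigma> i = i" if "\<not> i < k" for i
    using \<sigma> that by (auto simp: permutes_def)
  have eq: "double_perm k \<sigma> = \<sigma> \<circ> (\<rho> \<circ> (\<sigma> \<circ> \<rho>))"
  proof
    fix i
    consider "i < k" | "k \<le> i" "i < 2 * k" | "2 * k \<le> i" by linarith
    then show "double_perm k \<sigma> i = (\<sigma> \<circ> (\<rho> \<circ> (\<sigma> \<circ> \<rho>))) i"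
    proof cases
      case 2
      then have "\<sigma> (i - k) < k" by (simp add: lt)
      then show ?thesis using 2 fix_\<sigma> by (simp add: double_perm_def \<rho>_def add.commute)
    qed (use fix_\<sigma> in \<open>simp_all add: double_perm_def \<rho>_def\<close>)
  qed
  show "double_perm k \<sigma> permutes {0..<2 * k}"
    unfolding eq by (intro permutes_compose \<rho> \<sigma>')
  have "permutation \<sigma>" "permutation \<rho>"
    using \<sigma>' \<rho> by (auto simp: permutation_permutes)
  then show "sign (double_perm k \<sigma>) = 1"
    unfolding eq by (simp add: sign_compose permutation_compose mult_ac del: o_apply)
qed

text \<open>Every permutation is obtained exactly once from one with increasing tails by renumbering the
  edges: the renumbering is the permutation that sorts its tails.\<close>

lemma sum_sorted_perms_double_perm:
  fixes H :: "(nat \<Rightarrow> nat) \<Rightarrow> 'a :: comm_monoid_add"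
  shows "(\<Sum>p\<in>sorted_perms k. \<Sum>\<sigma> | \<sigma> permutes {0..<k}. H (p \<circ> double_perm k \<sigma>)) =
    (\<Sum>q | q permutes {0..<2 * k}. H q)"
proof -
  let ?S = "{\<sigma>. \<sigma> permutes {0..<k}}"
  let ?\<Phi> = "\<lambda>(p, \<sigma>). p \<circ> double_perm k \<sigma>"
  have img: "(p \<circ> double_perm k \<sigma>) ` {..<k} = p ` {..<k}" if "\<sigma> permutes {0..<k}" for p \<sigma>
  proof -
    have "(p \<circ> double_perm k \<sigma>) ` {..<k} = p ` (\<sigma> ` {..<k})"
      by (auto simp: double_perm_def image_iff)
    then show ?thesis
      using permutes_image[OF that] by (simp add: lessThan_atLeast0)
  qed
  have "bij_betw ?\<Phi> (sorted_perms k \<times> ?S) {q. q permutes {0..<2 * k}}"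
    unfolding bij_betw_def
  proof (intro conjI inj_onI equalityI subsetI)
    fix x y assume x: "x \<in> sorted_perms k \<times> ?S" and y: "y \<in> sorted_perms k \<times> ?S"
      and eq: "?\<Phi> x = ?\<Phi> y"
    obtain p \<sigma> q \<tau> where xy: "x = (p, \<sigma>)" "y = (q, \<tau>)" by fastforce
    have p: "p permutes {0..<2 * k}" "strict_mono_on {..<k} p"
      "q permutes {0..<2 * k}" "strict_mono_on {..<k} q"
      and \<sigma>: "\<sigma> permutes {0..<k}" "\<tau> permutes {0..<k}"
      using x y xy by (auto simp: sorted_perms_def)
    have eq: "p \<circ> double_perm k \<sigma> = q \<circ> double_perm k \<tau>"
      using eq by (simp add: xy)
    have "p ` {..<k} = q ` {..<k}"
      using img[OF \<sigma>(1), of p] img[OF \<sigma>(2), of q] eq by metis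
    then have pq: "p r = q r" if "r < k" for r
      using strict_mono_on_eq_pick[OF p(2) that] strict_mono_on_eq_pick[OF p(4) that] by simp
    have "\<sigma> r = \<tau> r" for r
    proof (cases "r < k")
      case True
      then have "p (\<sigma> r) = q (\<tau> r)"
        using fun_cong[OF eq, of r] by (simp add: double_perm_def)
      moreover have "\<sigma> r < k" "\<tau> r < k"
        using True permutes_in_image[OF \<sigma>(1), of r] permutes_in_image[OF \<sigma>(2), of r] by auto
      ultimately show ?thesis
        using pq permutes_inj[OF p(3)] by (simp add: inj_eq)
    next
      case False
      then show ?thesis using \<sigma> by (simp add: permutes_not_in)
    qed
    then have "\<sigma> = \<tau>" by blast
    moreover have "surj (double_perm k \<tau>)"
      using permutes_surj[OF double_perm_permutes[OF \<sigma>(2)]] .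
    ultimately have "p = q"
      using eq by (metis fun.map_comp surj_fun_eq)
    then show "x = y" using \<open>\<sigma> = \<tau>\<close> xy by simp
  next
    fix q assume "q \<in> ?\<Phi> ` (sorted_perms k \<times> ?S)"
    then show "q \<in> {q. q permutes {0..<2 * k}}"
      by (auto simp: sorted_perms_def intro!: permutes_compose double_perm_permutes)
  next
    fix q assume "q \<in> {q. q permutes {0..<2 * k}}"
    then have q: "q permutes {0..<2 * k}" by simp
    have q_inj: "inj_on q {..<k}"
      using permutes_inj[OF q] by (rule inj_on_subset) simp
    obtain \<sigma> where \<sigma>: "\<sigma> permutes {0..<k}" "\<And>r. r < k \<Longrightarrow> q r = pick (q ` {..<k}) (\<sigma> r)"
      using q_inj by (blast intro: obtain_sorting_permutation)
    let ?d = "double_perm k \<sigma>"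
    have d: "?d permutes {0..<2 * k}" using \<sigma>(1) by (rule double_perm_permutes)
    define p where "p = q \<circ> Hilbert_Choice.inv ?d"
    have p_pick: "p r = pick (q ` {..<k}) r" if "r < k" for r
    proof -
      have "Hilbert_Choice.inv \<sigma> r < k"
        using permutes_in_image[OF permutes_inv[OF \<sigma>(1)], of r] that by simp
      moreover from this have "?d (Hilbert_Choice.inv \<sigma> r) = r"
        using permutes_inverses[OF \<sigma>(1)] by (simp add: double_perm_def)
      ultimately show ?thesis
        using permutes_inverses[OF d] permutes_inverses[OF \<sigma>(1)] \<sigma>(2)[of "Hilbert_Choice.inv \<sigma> r"]
        by (simp add: p_def) (metis)
    qed
    have "strict_mono_on {..<k} p"
      using pick_mono_le[of _ "q ` {..<k}"] q_inj
      by (intro strict_mono_onI) (simp add: p_pick card_image)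
    moreover have "p permutes {0..<2 * k}"
      unfolding p_def by (intro permutes_compose permutes_inv d q)
    moreover have "q = p \<circ> ?d"
      unfolding p_def using permutes_inv_o[OF d] by (simp add: o_assoc[symmetric])
    ultimately show "q \<in> ?\<Phi> ` (sorted_perms k \<times> ?S)"
      using \<sigma>(1) by (auto simp: sorted_perms_def image_iff)
  qed
  from sum.reindex_bij_betw[OF this, of H] show ?thesis
    by (simp add: sum.cartesian_product case_prod_unfold)
qed

section \<open>Expansions of Cauchy-Binet type\<close>

text \<open>The predicate \<open>P\<close> splits \<open>S\<close> into two halves exchanged by \<open>t\<close>. Pairing these off, rather than
  concluding from \<open>sum w S = - sum w S\<close>, makes the result hold in the presence of 2-torsion.\<close>

lemma sum_sign_reversing_involution:
  fixes w :: "'b \<Rightarrow> 'a :: ab_group_add"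
  assumes "finite S"
    and t: "\<And>p. p \<in> S \<Longrightarrow> t p \<in> S" "\<And>p. p \<in> S \<Longrightarrow> t (t p) = p"
    and P: "\<And>p. p \<in> S \<Longrightarrow> P (t p) \<longleftrightarrow> \<not> P p"
    and w: "\<And>p. p \<in> S \<Longrightarrow> w (t p) = - w p"
  shows "sum w S = 0"
proof -
  have "sum w S = sum w {p \<in> S. P p} + sum w {p \<in> S. \<not> P p}"
    using assms(1) by (subst sum.union_disjoint[symmetric]) (auto intro: sum.cong)
  also have "sum w {p \<in> S. \<not> P p} = sum (\<lambda>p. - w p) {p \<in> S. P p}"
    by (rule sum.reindex_bij_witness[of _ t t]) (auto simp: t P w)
  finally show ?thesis by (simp add: sum_negf)
qed

text \<open>Exchanging the heads of edges \<open>r\<close> and \<open>s\<close> reverses the sign. For the set of all permutations this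
  is the vanishing of a determinant with two equal columns; the general set \<open>S\<close> also covers
  \<open>sorted_perms k\<close>, whose defining condition concerns only the tails.\<close>

lemma sum_perms_equal_columns:
  fixes u v :: "nat \<Rightarrow> nat \<Rightarrow> 'a :: comm_ring_1"
  assumes S: "S \<subseteq> {p. p permutes {0..<2 * k}}"
    and closed: "\<And>p. p \<in> S \<Longrightarrow> p \<circ> Transposition.transpose (k + r) (k + s) \<in> S"
    and rs: "r < k" "s < k" "r \<noteq> s" and eq: "v r = v s"
  shows "(\<Sum>p\<in>S. of_int (sign p) * (\<Prod>i<k. u i (p i) * v i (p (k + i)))) = 0"
proof -
  let ?t = "Transposition.transpose (k + r) (k + s)" and ?\<tau> = "Transposition.transpose r s"
  have t: "?t permutes {0..<2 * k}"
    using rs by (intro permutes_swap_id) auto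
  have \<tau>: "?\<tau> permutes {..<k}"
    using rs by (intro permutes_swap_id) auto
  show ?thesis
  proof (rule sum_sign_reversing_involution[where t = "\<lambda>p. p \<circ> ?t" and P = "\<lambda>p. p (k + r) < p (k + s)"])
    show "finite S"
      using S by (rule finite_subset) (simp add: finite_permutations)
    fix p assume p: "p \<in> S"
    then have perm: "p permutes {0..<2 * k}" using S by auto
    show "p \<circ> ?t \<in> S" using p by (rule closed)
    show "(p \<circ> ?t) \<circ> ?t = p" by (simp add: o_assoc[symmetric])
    show "(p \<circ> ?t) (k + r) < (p \<circ> ?t) (k + s) \<longleftrightarrow> \<not> p (k + r) < p (k + s)"
      using inj_eq[OF permutes_inj[OF perm], of "k + r" "k + s"] rs by auto
    have "permutation p" "permutation ?t"
      using perm t by (auto simp: permutation_permutes)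
    then have sgn: "sign (p \<circ> ?t) = - sign p"
      using rs by (simp add: sign_compose sign_swap_id del: o_apply)
    have "(\<Prod>i<k. v i (p (?t (k + i)))) = (\<Prod>i<k. v (?\<tau> i) (p (k + ?\<tau> i)))"
      using eq by (intro prod.cong refl) (auto simp: Transposition.transpose_def)
    also have "\<dots> = (\<Prod>i<k. v i (p (k + i)))"
      using prod.permute[OF \<tau>, of "\<lambda>i. v i (p (k + i))"] by (simp add: o_def)
    finally have "(\<Prod>i<k. v i ((p \<circ> ?t) (k + i))) = (\<Prod>i<k. v i (p (k + i)))"
      by simp
    moreover have "(\<Prod>i<k. u i ((p \<circ> ?t) i)) = (\<Prod>i<k. u i (p i))"
      by (intro prod.cong refl) (auto simp: Transposition.transpose_def)
    ultimately show "of_int (sign (p \<circ> ?t)) * (\<Prod>i<k. u i ((p \<circ> ?t) i) * v i ((p \<circ> ?t) (k + i))) =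
        - (of_int (sign p) * (\<Prod>i<k. u i (p i) * v i (p (k + i))))"
      unfolding prod.distrib sgn by simp
  qed
qed

lemma prod_lessThan_permute:
  fixes f :: "nat \<Rightarrow> 'a :: comm_monoid_mult"
  assumes "\<sigma> permutes {0..<k}"
  shows "(\<Prod>r<k. f (\<sigma> r)) = (\<Prod>r<k. f r)"
  using prod.permute[OF assms, of f] by (simp add: lessThan_atLeast0 o_def)

text \<open>The right-hand side is a sum of determinants of \<open>U\<^sup>I V\<^sup>I\<close>. On the left the tails are increasing and
  the columns \<open>c\<close> attached to the edges are arbitrary. Distinct columns are sorted by a permutation
  \<open>\<sigma>\<close>; renumbering the edges accordingly sorts the columns and frees the tails.\<close>

lemma sum_sorted_perms_cauchy_binet:
  fixes U V :: "nat \<Rightarrow> nat \<Rightarrow> 'a :: comm_ring_1"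
  shows "(\<Sum>p\<in>sorted_perms k. of_int (sign p) * (\<Prod>r<k. \<Sum>c = 0..<n. U (p r) c * V (p (k + r)) c)) =
    (\<Sum>I | I \<subseteq> {0..<n} \<and> card I = k. \<Sum>q | q permutes {0..<2 * k}.
      of_int (sign q) * (\<Prod>r<k. U (q r) (pick I r) * V (q (k + r)) (pick I r)))"
proof -
  define F where "F g = (\<Sum>p\<in>sorted_perms k. of_int (sign p) *
    (\<Prod>r<k. U (p r) (g r) * V (p (k + r)) (g r)))" for g
  have "(\<Sum>p\<in>sorted_perms k. of_int (sign p) * (\<Prod>r<k. \<Sum>c = 0..<n. U (p r) c * V (p (k + r)) c)) =
      (\<Sum>g\<in>{..<k} \<rightarrow>\<^sub>E {0..<n}. F g)"
    unfolding F_def by (subst sum.swap) (simp add: prod_sum_PiE sum_distrib_left)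
  also have "\<dots> = (\<Sum>I | I \<subseteq> {0..<n} \<and> card I = k. \<Sum>\<sigma> | \<sigma> permutes {0..<k}. F (\<lambda>r. pick I (\<sigma> r)))"
  proof (rule sum_functions_by_image)
    fix g r s assume rs: "r < k" "s < k" "r \<noteq> s" "g r = (g s :: nat)"
    \<comment> \<open>Only heads are exchanged, so the tails stay increasing.\<close>
    have "p \<circ> Transposition.transpose (k + r) (k + s) \<in> sorted_perms k" if "p \<in> sorted_perms k" for p
      using that rs unfolding sorted_perms_def
      by (auto intro!: permutes_compose permutes_swap_id strict_mono_onI
          simp: strict_mono_on_less Transposition.transpose_def)
    then show "F g = 0"
      unfolding F_def using rs
      by (intro sum_perms_equal_columns[where r = r and s = s and u = "\<lambda>i x. U x (g i)"
            and v = "\<lambda>i x. V x (g i)"]) (auto simp: sorted_perms_def)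
  qed (simp add: F_def)
  also have "\<dots> = (\<Sum>I | I \<subseteq> {0..<n} \<and> card I = k. \<Sum>q | q permutes {0..<2 * k}.
      of_int (sign q) * (\<Prod>r<k. U (q r) (pick I r) * V (q (k + r)) (pick I r)))"
  proof (rule sum.cong[OF refl])
    fix I
    define H where "H q = of_int (sign q) *
      (\<Prod>r<k. U (q r) (pick I r) * V (q (k + r)) (pick I r))" for q
    have H: "H (p \<circ> double_perm k \<sigma>) = of_int (sign p) *
        (\<Prod>r<k. U (p r) (pick I (Hilbert_Choice.inv \<sigma> r)) * V (p (k + r)) (pick I (Hilbert_Choice.inv \<sigma> r)))"
      if p: "p \<in> sorted_perms k" and \<sigma>: "\<sigma> permutes {0..<k}" for p \<sigma>
    proof -
      have "permutation p" "permutation (double_perm k \<sigma>)"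
        using p double_perm_permutes[OF \<sigma>] by (auto simp: permutation_permutes sorted_perms_def)
      then have "sign (p \<circ> double_perm k \<sigma>) = sign p"
        by (simp add: sign_compose sign_double_perm[OF \<sigma>] del: o_apply)
      then have "H (p \<circ> double_perm k \<sigma>) = of_int (sign p) *
          (\<Prod>r<k. U (p (\<sigma> r)) (pick I r) * V (p (k + \<sigma> r)) (pick I r))"
        by (simp add: H_def double_perm_def)
      also have "(\<Prod>r<k. U (p (\<sigma> r)) (pick I r) * V (p (k + \<sigma> r)) (pick I r)) =
          (\<Prod>r<k. U (p r) (pick I (Hilbert_Choice.inv \<sigma> r)) * V (p (k + r)) (pick I (Hilbert_Choice.inv \<sigma> r)))"
        by (subst prod_lessThan_permute[OF \<sigma>, symmetric]) (simp add: permutes_inverses[OF \<sigma>])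
      finally show ?thesis .
    qed
    have "(\<Sum>\<sigma> | \<sigma> permutes {0..<k}. F (\<lambda>r. pick I (\<sigma> r))) =
        (\<Sum>\<sigma> | \<sigma> permutes {0..<k}. F (\<lambda>r. pick I (Hilbert_Choice.inv \<sigma> r)))"
      by (rule sum.reindex_bij_witness[of _ Hilbert_Choice.inv Hilbert_Choice.inv])
        (auto simp: permutes_inv permutes_inv_inv)
    also have "\<dots> = (\<Sum>p\<in>sorted_perms k. \<Sum>\<sigma> | \<sigma> permutes {0..<k}. H (p \<circ> double_perm k \<sigma>))"
      unfolding F_def by (subst sum.swap) (auto intro!: sum.cong simp: H simp del: o_apply)
    also have "\<dots> = (\<Sum>q | q permutes {0..<2 * k}. H q)"
      by (rule sum_sorted_perms_double_perm)
    finally show "(\<Sum>\<sigma> | \<sigma> permutes {0..<k}. F (\<lambda>r. pick I (\<sigma> r))) = (\<Sum>q | q permutes {0..<2 * k}.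
      of_int (sign q) * (\<Prod>r<k. U (q r) (pick I r) * V (q (k + r)) (pick I r)))"
      unfolding H_def .
  qed
  finally show ?thesis .
qed

text \<open>The left-hand side is the determinant of the columns \<open>U\<close> followed by the columns of \<open>V W\<^sup>t\<close>.
  Expanding each of the latter as a combination of columns of \<open>V\<close>, choices with a repeated column
  vanish, and the others are sorted; the signs of the sorting permutations collect into a minor
  of \<open>W\<close>.\<close>

lemma sum_perms_cauchy_binet:
  fixes U V :: "nat \<Rightarrow> nat \<Rightarrow> 'a :: comm_ring_1" and W :: "nat \<Rightarrow> nat \<Rightarrow> 'a"
  shows "(\<Sum>p | p permutes {0..<2 * k}. of_int (sign p) *
      (\<Prod>r<k. U (p r) r * (\<Sum>c = 0..<n. W r c * V (p (k + r)) c))) =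
    (\<Sum>J | J \<subseteq> {0..<n} \<and> card J = k.
      (\<Sum>\<sigma> | \<sigma> permutes {0..<k}. of_int (sign \<sigma>) * (\<Prod>r<k. W r (pick J (\<sigma> r)))) *
      (\<Sum>p | p permutes {0..<2 * k}. of_int (sign p) * (\<Prod>r<k. U (p r) r * V (p (k + r)) (pick J r))))"
proof -
  let ?P = "{p. p permutes {0..<2 * k}}"
  define D where "D g = (\<Sum>p\<in>?P. of_int (sign p) * (\<Prod>r<k. U (p r) r * V (p (k + r)) (g r)))" for g
  define F where "F g = (\<Prod>r<k. W r (g r)) * D g" for g
  have "(\<Sum>p\<in>?P. of_int (sign p) * (\<Prod>r<k. U (p r) r * (\<Sum>c = 0..<n. W r c * V (p (k + r)) c))) =
      (\<Sum>g\<in>{..<k} \<rightarrow>\<^sub>E {0..<n}. F g)"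
    unfolding F_def D_def sum_distrib_left
    by (subst sum.swap) (simp add: prod_sum_PiE sum_distrib_left prod.distrib mult_ac)
  also have "\<dots> = (\<Sum>J | J \<subseteq> {0..<n} \<and> card J = k. \<Sum>\<sigma> | \<sigma> permutes {0..<k}. F (\<lambda>r. pick J (\<sigma> r)))"
  proof (rule sum_functions_by_image)
    fix g r s assume rs: "r < k" "s < k" "r \<noteq> s" "g r = (g s :: nat)"
    have "D g = 0"
      unfolding D_def using rs
      by (intro sum_perms_equal_columns[where r = r and s = s and u = "\<lambda>i x. U x i"
            and v = "\<lambda>i x. V x (g i)"]) (auto intro!: permutes_compose permutes_swap_id)
    then show "F g = 0" by (simp add: F_def)
  qed (simp add: F_def D_def)
  also have "\<dots> = (\<Sum>J | J \<subseteq> {0..<n} \<and> card J = k.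
      (\<Sum>\<sigma> | \<sigma> permutes {0..<k}. of_int (sign \<sigma>) * (\<Prod>r<k. W r (pick J (\<sigma> r)))) * D (pick J))"
  proof (rule sum.cong[OF refl])
    fix J
    have "F (\<lambda>r. pick J (\<sigma> r)) = of_int (sign \<sigma>) * (\<Prod>r<k. W r (pick J (\<sigma> r))) * D (pick J)"
      if \<sigma>: "\<sigma> permutes {0..<k}" for \<sigma>
    proof -
      \<comment> \<open>Renumbers the heads alone: on the tail positions the two factors cancel. As doubled permutations
      are even, \<open>s\<close> has the sign of \<open>\<sigma>\<close>.\<close>
      define s where "s = \<sigma> \<circ> double_perm k (Hilbert_Choice.inv \<sigma>)"
      have inv: "Hilbert_Choice.inv \<sigma> permutes {0..<k}"
        using \<sigma> by (rule permutes_inv)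
      have \<sigma>': "\<sigma> permutes {0..<2 * k}"
        using \<sigma> by (rule permutes_subset) auto
      have s: "s permutes {0..<2 * k}"
        unfolding s_def by (intro permutes_compose double_perm_permutes inv \<sigma>')
      have s_low: "s r = r" and s_high: "s (k + r) = k + Hilbert_Choice.inv \<sigma> r" if "r < k" for r
        using that permutes_inverses[OF \<sigma>] permutes_not_in[OF \<sigma>]
        by (simp_all add: s_def double_perm_def)
      have "permutation \<sigma>" "permutation (double_perm k (Hilbert_Choice.inv \<sigma>))"
        using \<sigma>' double_perm_permutes[OF inv] by (auto simp: permutation_permutes)
      then have sign_s: "sign s = sign \<sigma>"
        by (simp add: s_def sign_compose sign_double_perm[OF inv] del: o_apply)
      have "of_int (sign p) * (\<Prod>r<k. U (p r) r * V (p (k + r)) (pick J (\<sigma> r))) =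
          of_int (sign \<sigma>) * (of_int (sign (p \<circ> s)) *
            (\<Prod>r<k. U ((p \<circ> s) r) r * V ((p \<circ> s) (k + r)) (pick J r)))"
        if p: "p permutes {0..<2 * k}" for p
      proof -
        have "(\<Prod>r<k. V (p (k + r)) (pick J (\<sigma> r))) = (\<Prod>r<k. V ((p \<circ> s) (k + r)) (pick J r))"
          by (subst prod_lessThan_permute[OF inv, symmetric])
            (simp add: s_high permutes_inverses[OF \<sigma>])
        moreover have "(\<Prod>r<k. U (p r) r) = (\<Prod>r<k. U ((p \<circ> s) r) r)"
          by (simp add: s_low)
        moreover have "sign p = sign \<sigma> * sign (p \<circ> s)"
          using p s by (subst sign_compose) (auto simp: permutation_permutes sign_s)
        ultimately show ?thesis by (simp add: prod.distrib mult.assoc del: o_apply)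
      qed
      then have "D (\<lambda>r. pick J (\<sigma> r)) = of_int (sign \<sigma>) * (\<Sum>p\<in>?P. of_int (sign (p \<circ> s)) *
            (\<Prod>r<k. U ((p \<circ> s) r) r * V ((p \<circ> s) (k + r)) (pick J r)))"
        unfolding D_def sum_distrib_left by (intro sum.cong) auto
      also have "\<dots> = of_int (sign \<sigma>) * D (pick J)"
        unfolding D_def by (subst sum_permutations_compose_right[OF s]) (rule refl)
      finally show ?thesis by (simp add: F_def mult_ac)
    qed
    then show "(\<Sum>\<sigma> | \<sigma> permutes {0..<k}. F (\<lambda>r. pick J (\<sigma> r))) =
      (\<Sum>\<sigma> | \<sigma> permutes {0..<k}. of_int (sign \<sigma>) * (\<Prod>r<k. W r (pick J (\<sigma> r)))) * D (pick J)"
      by (simp add: sum_distrib_right)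
  qed
  finally show ?thesis unfolding D_def .
qed

section \<open>The Pfaffian as a sum over directed matchings\<close>

lemma perfect_matchings_edge:
  assumes "M \<in> perfect_matchings m" "e \<in> M"
  shows "finite e" "e = {Min e, Max e}" "Min e < Max e" "e \<subseteq> {0..<m}" "Max e < m"
proof -
  have "card e = 2" and sub: "e \<subseteq> {0..<m}"
    using assms by (auto simp: perfect_matchings_def partition_on_def)
  then obtain x y where "e = {x, y}" "x \<noteq> y" by (auto simp: card_2_iff)
  then show "finite e" "e = {Min e, Max e}" "Min e < Max e" by (auto simp: min_def max_def)
  show "e \<subseteq> {0..<m}" by (rule sub)
  show "Max e < m" using sub \<open>e = {x, y}\<close> by auto
qed

lemma perfect_matchings_edge_unique:
  assumes "M \<in> perfect_matchings m" "e \<in> M" "e' \<in> M" "x \<in> e" "x \<in> e'"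
  shows "e = e'"
  using assms unfolding perfect_matchings_def partition_on_def disjoint_def by blast

lemma finite_perfect_matchings: "finite (perfect_matchings m)"
  by (rule finite_subset[OF _ finitely_many_partition_on[of "{0..<m}"]])
    (auto simp: perfect_matchings_def)

lemma finite_perfect_matching:
  assumes "M \<in> perfect_matchings m"
  shows "finite M"
  using assms by (auto simp: perfect_matchings_def intro: finite_elements[of "{0..<m}"])

lemma card_perfect_matching:
  assumes "M \<in> perfect_matchings (2 * k)"
  shows "card M = k"
proof -
  have "2 * k = card (\<Union>M)"
    using assms by (auto simp: perfect_matchings_def partition_on_def)
  also have "\<dots> = (\<Sum>e\<in>M. card e)"
    using assms perfect_matchings_edge(1)[OF assms]
    by (intro card_Union_disjoint)
      (auto simp: perfect_matchings_def partition_on_def disjoint_def pairwise_def disjnt_def)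
  also have "\<dots> = 2 * card M"
    using assms by (simp add: perfect_matchings_def)
  finally show ?thesis by simp
qed

lemma matching_of_perfect:
  assumes p: "p permutes {0..<2 * k}"
  shows "matching_of k p \<in> perfect_matchings (2 * k)"
proof -
  have "(\<Union>r<k. {p r, p (k + r)}) = p ` {0..<2 * k}"
  proof (intro equalityI subsetI)
    fix x assume "x \<in> p ` {0..<2 * k}"
    then obtain i where i: "x = p i" "i < 2 * k" by auto
    show "x \<in> (\<Union>r<k. {p r, p (k + r)})"
    proof (cases "i < k")
      case False
      then have "i = k + (i - k)" "i - k < k" using i by auto
      then show ?thesis using i by (metis UN_I insertI1 insertI2 lessThan_iff)
    qed (use i in auto)
  qed auto
  then have "\<Union> (matching_of k p) = {0..<2 * k}"
    using permutes_image[OF p] by (simp add: matching_of_def)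
  moreover have "disjoint (matching_of k p)"
    unfolding disjoint_def
  proof (intro ballI impI)
    fix e e' assume "e \<in> matching_of k p" "e' \<in> matching_of k p" "e \<noteq> e'"
    then obtain r s where "r < k" "s < k" "e = {p r, p (k + r)}" "e' = {p s, p (k + s)}" "r \<noteq> s"
      by (auto simp: matching_of_def)
    then show "e \<inter> e' = {}"
      using endpoints_distinct[OF p, of r s] by auto
  qed
  moreover have "card e = 2" if "e \<in> matching_of k p" for e
    using that by (auto simp: matching_of_def inj_eq[OF permutes_inj[OF p]])
  moreover have "{} \<notin> matching_of k p"
    by (auto simp: matching_of_def)
  ultimately show ?thesis
    by (auto simp: perfect_matchings_def partition_on_def)
qed

lemma inj_on_edges:
  fixes p :: "nat \<Rightarrow> nat"
  assumes p: "p permutes {0..<2 * k}"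
  shows "inj_on (\<lambda>r. {p r, p (k + r)}) {..<k}"
proof (rule inj_onI)
  fix r s assume "r \<in> {..<k}" "s \<in> {..<k}" "{p r, p (k + r)} = {p s, p (k + s)}"
  then show "r = s"
    using endpoints_distinct[OF p, of r s] by (cases "r = s") (auto simp: doubleton_eq_iff)
qed

text \<open>Given its underlying matching, a directed matching is encoded by the set \<open>R\<close> of edges whose tail is
  the larger end; \<open>edge_tail R\<close> and \<open>edge_head R\<close> recover the direction.\<close>

definition reversed_edges :: "nat \<Rightarrow> (nat \<Rightarrow> nat) \<Rightarrow> nat set set" where
  "reversed_edges k p = (\<lambda>r. {p r, p (k + r)}) ` {r. r < k \<and> p (k + r) < p r}"

definition edge_tail :: "nat set set \<Rightarrow> nat set \<Rightarrow> nat" where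
  "edge_tail R e = (if e \<in> R then Max e else Min e)"

definition edge_head :: "nat set set \<Rightarrow> nat set \<Rightarrow> nat" where
  "edge_head R e = (if e \<in> R then Min e else Max e)"

lemma edge_in_reversed_edges:
  assumes "p permutes {0..<2 * k}" "r < k"
  shows "{p r, p (k + r)} \<in> reversed_edges k p \<longleftrightarrow> p (k + r) < p r"
  using inj_on_image_mem_iff[OF inj_on_edges[OF assms(1)], of r "{r. r < k \<and> p (k + r) < p r}"] assms(2)
  by (auto simp: reversed_edges_def)

lemma
  assumes "p permutes {0..<2 * k}" "r < k"
  shows edge_tail_reversed_edges: "edge_tail (reversed_edges k p) {p r, p (k + r)} = p r"
    and edge_head_reversed_edges: "edge_head (reversed_edges k p) {p r, p (k + r)} = p (k + r)"
  using edge_in_reversed_edges[OF assms]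
  by (auto simp: edge_tail_def edge_head_def min_def max_def)

text \<open>The matching and the set of reversed edges determine the set of tails, hence the increasing list of
  tails, and the head of an edge is the other end. Conversely any \<open>R \<subseteq> M\<close> arises by listing the edges of
  \<open>M\<close> in the order of their tails under \<open>R\<close>.\<close>

lemma bij_betw_reversed_edges:
  assumes M: "M \<in> perfect_matchings (2 * k)"
  shows "bij_betw (reversed_edges k) {p \<in> sorted_perms k. matching_of k p = M} (Pow M)"
  unfolding bij_betw_def
proof (intro conjI inj_onI equalityI subsetI)
  fix p q assume p: "p \<in> {p \<in> sorted_perms k. matching_of k p = M}"
    and q: "q \<in> {p \<in> sorted_perms k. matching_of k p = M}"
    and eq: "reversed_edges k p = reversed_edges k q"
  let ?R = "reversed_edges k p"
  have perm: "p permutes {0..<2 * k}" "q permutes {0..<2 * k}"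
    and mono: "strict_mono_on {..<k} p" "strict_mono_on {..<k} q"
    using p q by (auto simp: sorted_perms_def)
  have "p ` {..<k} = edge_tail ?R ` M"
  proof -
    have "p ` {..<k} = edge_tail ?R ` matching_of k p"
      unfolding matching_of_def image_image
      by (intro image_cong) (simp_all add: edge_tail_reversed_edges[OF perm(1)])
    with p show ?thesis by simp
  qed
  moreover have "q ` {..<k} = edge_tail ?R ` M"
  proof -
    have "q ` {..<k} = edge_tail ?R ` matching_of k q"
      unfolding matching_of_def image_image eq
      by (intro image_cong) (simp_all add: edge_tail_reversed_edges[OF perm(2)])
    with q show ?thesis by simp
  qed
  ultimately have low: "p r = q r" if "r < k" for r
    using strict_mono_on_eq_pick[OF mono(1) that] strict_mono_on_eq_pick[OF mono(2) that] by simp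
  have high: "p (k + r) = q (k + r)" if "r < k" for r
  proof -
    have "{p r, p (k + r)} \<in> M" "{q r, q (k + r)} \<in> M"
      using p q that by (auto simp: matching_of_def)
    then have "{p r, p (k + r)} = {q r, q (k + r)}"
      by (rule perfect_matchings_edge_unique[OF M, where x = "p r"]) (auto simp: low[OF that])
    then show ?thesis
      using edge_head_reversed_edges[OF perm(1) that] edge_head_reversed_edges[OF perm(2) that] eq
      by simp
  qed
  show "p = q"
  proof
    fix i
    consider "i < k" | "i = k + (i - k)" "i - k < k" | "2 * k \<le> i" by linarith
    then show "p i = q i"
    proof cases
      case 2 then show ?thesis using high[of "i - k"] by simp
    next
      case 3 then show ?thesis using perm by (simp add: permutes_not_in)
    qed (rule low)
  qed
next
  fix R assume "R \<in> reversed_edges k ` {p \<in> sorted_perms k. matching_of k p = M}"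
  then show "R \<in> Pow M" by (auto simp: reversed_edges_def matching_of_def)
next
  fix R assume "R \<in> Pow M"
  let ?S = "edge_tail R ` M"
  have ends: "edge_tail R e \<in> e" "edge_head R e \<in> e" "edge_tail R e \<noteq> edge_head R e"
    "e = {edge_tail R e, edge_head R e}" "edge_head R e < edge_tail R e \<longleftrightarrow> e \<in> R"
    if "e \<in> M" for e
    using perfect_matchings_edge(2,3)[OF M that]
    by (auto simp: edge_tail_def edge_head_def)
  have uniq: "e = e'" if "e \<in> M" "e' \<in> M" "x \<in> e" "x \<in> e'" for e e' x
    using perfect_matchings_edge_unique[OF M] that by blast
  have inj: "inj_on (edge_tail R) M"
    using ends(1) uniq by (metis inj_onI)
  have finM: "finite M" using M by (rule finite_perfect_matching)
  have pickS: "bij_betw (pick ?S) {..<k} ?S"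
    using inj finM card_perfect_matching[OF M] by (intro pick_bij_betw) (auto simp: card_image)
  have "bij_betw (edge_tail R) M ?S" using inj by (simp add: bij_betw_def)
  \<comment> \<open>The edges of \<open>M\<close>, numbered by increasing tails.\<close>
  define h where "h = inv_into M (edge_tail R) \<circ> pick ?S"
  have h: "bij_betw h {..<k} M"
    unfolding h_def by (intro bij_betw_trans[OF pickS] bij_betw_inv_into) fact
  have hM: "h r \<in> M" if "r < k" for r
    using h that by (auto simp: bij_betw_def)
  have h_eq: "h r = h s \<longleftrightarrow> r = s" if "r < k" "s < k" for r s
    using h that by (auto simp: bij_betw_def inj_on_eq_iff)
  have tail_h: "edge_tail R (h r) = pick ?S r" if "r < k" for r
    using that pickS unfolding h_def by (auto simp: bij_betw_def intro!: f_inv_into_f)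
  define p where "p i = (if i < k then edge_tail R (h i)
    else if i < 2 * k then edge_head R (h (i - k)) else i)" for i
  have p_low: "p r = edge_tail R (h r)" and p_high: "p (k + r) = edge_head R (h r)" if "r < k" for r
    using that by (auto simp: p_def)
  have p_edge: "{p r, p (k + r)} = h r" if "r < k" for r
    using ends(4)[OF hM[OF that]] by (simp add: p_low p_high that)
  have "inj_on p {0..<2 * k}"
  proof (rule inj_onI)
    fix i j assume i: "i \<in> {0..<2 * k}" and j: "j \<in> {0..<2 * k}" and eq: "p i = p j"
    define r s where "r = (if i < k then i else i - k)" and "s = (if j < k then j else j - k)"
    have rs: "r < k" "s < k" using i j by (auto simp: r_def s_def)
    have "p i \<in> h r" "p j \<in> h s"
      using i j rs ends(1,2)[OF hM] by (auto simp: p_def r_def s_def)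
    then have "h r = h s"
      using eq uniq hM rs by metis
    then have "r = s" using rs by (simp add: h_eq)
    then show "i = j"
      using eq i j ends(3)[OF hM[OF rs(1)]]
      by (auto simp: p_def r_def s_def split: if_splits)
  qed
  moreover have "p ` {0..<2 * k} \<subseteq> {0..<2 * k}"
  proof clarify
    fix i assume i: "i \<in> {0..<2 * k}"
    define r where "r = (if i < k then i else i - k)"
    have "h r \<in> M" using i by (intro hM) (auto simp: r_def)
    then have "\<exists>e\<in>M. p i \<in> e"
      using i ends(1,2)[of "h r"] by (intro bexI[of _ "h r"]) (auto simp: p_def r_def)
    then show "p i \<in> {0..<2 * k}"
      using perfect_matchings_edge(4)[OF M] by blast
  qed
  ultimately have "bij_betw p {0..<2 * k} {0..<2 * k}"
    by (simp add: bij_betw_def endo_inj_surj)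
  then have perm: "p permutes {0..<2 * k}"
    by (rule bij_imp_permutes) (auto simp: p_def)
  have "strict_mono_on {..<k} p"
    using pick_mono_le[of _ ?S] card_perfect_matching[OF M] inj
    by (intro strict_mono_onI) (simp add: p_low tail_h card_image)
  then have "p \<in> sorted_perms k"
    using perm by (simp add: sorted_perms_def)
  moreover have "matching_of k p = h ` {..<k}"
    unfolding matching_of_def using p_edge by auto
  then have "matching_of k p = M"
    using h by (simp add: bij_betw_def)
  moreover have "reversed_edges k p = h ` {r. r < k \<and> h r \<in> R}"
    unfolding reversed_edges_def
  proof (rule image_cong)
    show "{r. r < k \<and> p (k + r) < p r} = {r. r < k \<and> h r \<in> R}"
      using ends(5)[OF hM] by (auto simp: p_low p_high)
  qed (simp add: p_edge)
  then have "reversed_edges k p = R"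
    using h \<open>R \<in> Pow M\<close> by (auto simp: bij_betw_def)
  ultimately show "R \<in> reversed_edges k ` {p \<in> sorted_perms k. matching_of k p = M}"
    by blast
qed

text \<open>The contribution of one directed matching to both sides of \<open>pfaffian_skew_part\<close>: the order sign of
  an edge supplies the minus sign in front of \<open>Z (Max e) (Min e)\<close>.\<close>

lemma signed_prod_edges:
  fixes Z :: "nat \<Rightarrow> nat \<Rightarrow> 'a :: comm_ring_1"
  assumes p: "p permutes {0..<2 * k}"
  shows "(- 1) ^ (k choose 2) * (of_int (sign p) * (\<Prod>r<k. Z (p r) (p (k + r)))) =
    (- 1) ^ crossings (matching_of k p) *
      ((\<Prod>e\<in>reversed_edges k p. - Z (Max e) (Min e)) *
       (\<Prod>e\<in>matching_of k p - reversed_edges k p. Z (Min e) (Max e)))"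
proof -
  let ?M = "matching_of k p" and ?R = "reversed_edges k p"
  let ?f = "\<lambda>e. if e \<in> ?R then - Z (Max e) (Min e) else Z (Min e) (Max e)"
  have "(\<Prod>r<k. of_int (order_sign (p r) (p (k + r))) * Z (p r) (p (k + r))) =
      (\<Prod>r<k. ?f {p r, p (k + r)})"
  proof (rule prod.cong[OF refl])
    fix r assume "r \<in> {..<k}"
    moreover from this have "p r \<noteq> p (k + r)"
      by (simp add: inj_eq[OF permutes_inj[OF p]])
    ultimately show "of_int (order_sign (p r) (p (k + r))) * Z (p r) (p (k + r)) = ?f {p r, p (k + r)}"
      using edge_in_reversed_edges[OF p, of r] by (auto simp: order_sign_def)
  qed
  also have "\<dots> = prod ?f ?M"
    unfolding matching_of_def by (simp add: prod.reindex[OF inj_on_edges[OF p]])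
  also have "\<dots> = (\<Prod>e\<in>?R. - Z (Max e) (Min e)) * (\<Prod>e\<in>?M - ?R. Z (Min e) (Max e))"
  proof -
    have "?M \<inter> {e. e \<in> ?R} = ?R" "?M \<inter> - {e. e \<in> ?R} = ?M - ?R" "finite ?M"
      by (auto simp: reversed_edges_def matching_of_def)
    then show ?thesis by (simp only: prod.If_cases)
  qed
  finally have main: "of_int (\<Prod>r<k. order_sign (p r) (p (k + r))) * (\<Prod>r<k. Z (p r) (p (k + r))) =
      (\<Prod>e\<in>?R. - Z (Max e) (Min e)) * (\<Prod>e\<in>?M - ?R. Z (Min e) (Max e))"
    by (simp add: prod.distrib)
  have sq: "(- 1) ^ j * ((- 1) ^ j * x) = x" for j and x :: 'a
    by (simp add: mult.assoc[symmetric] power_mult_distrib[symmetric])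
  show ?thesis
    unfolding sign_matching_of[OF p] main[symmetric]
    by (simp add: mult.assoc sq)
qed

text \<open>The left-hand side is the Pfaffian of \<open>Z - Z\<^sup>t\<close>. Expanding the product over \<open>e \<in> M\<close> chooses a set
  \<open>R \<subseteq> M\<close> of reversed edges, and the pairs \<open>(M, R)\<close> correspond to the permutations with increasing tails.\<close>

lemma pfaffian_skew_part:
  fixes Z :: "nat \<Rightarrow> nat \<Rightarrow> 'a :: comm_ring_1"
  shows "(\<Sum>M\<in>perfect_matchings (2 * k). (- 1) ^ crossings M *
      (\<Prod>e\<in>M. Z (Min e) (Max e) - Z (Max e) (Min e))) =
    (- 1) ^ (k choose 2) *
      (\<Sum>p\<in>sorted_perms k. of_int (sign p) * (\<Prod>r<k. Z (p r) (p (k + r))))"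
proof -
  let ?T = "\<lambda>M R. (- 1) ^ crossings M *
    ((\<Prod>e\<in>R. - Z (Max e) (Min e)) * (\<Prod>e\<in>M - R. Z (Min e) (Max e)))"
  have fin: "finite (sorted_perms k)"
    by (rule finite_subset[OF _ finite_permutations[of "{0..<2 * k}"]]) (auto simp: sorted_perms_def)
  have img: "matching_of k ` sorted_perms k \<subseteq> perfect_matchings (2 * k)"
    by (auto simp: sorted_perms_def matching_of_perfect)
  have "(\<Sum>M\<in>perfect_matchings (2 * k). (- 1) ^ crossings M *
      (\<Prod>e\<in>M. Z (Min e) (Max e) - Z (Max e) (Min e))) =
      (\<Sum>M\<in>perfect_matchings (2 * k). \<Sum>R\<in>Pow M. ?T M R)"
  proof (rule sum.cong[OF refl])
    fix M assume "M \<in> perfect_matchings (2 * k)"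
    then have "finite M" by (rule finite_perfect_matching)
    then have "(\<Prod>e\<in>M. - Z (Max e) (Min e) + Z (Min e) (Max e)) =
        (\<Sum>R\<in>Pow M. (\<Prod>e\<in>R. - Z (Max e) (Min e)) * (\<Prod>e\<in>M - R. Z (Min e) (Max e)))"
      by (rule prod_add)
    then show "(- 1) ^ crossings M * (\<Prod>e\<in>M. Z (Min e) (Max e) - Z (Max e) (Min e)) =
        (\<Sum>R\<in>Pow M. ?T M R)"
      by (simp add: sum_distrib_left)
  qed
  also have "\<dots> = (\<Sum>M\<in>perfect_matchings (2 * k). \<Sum>p | p \<in> sorted_perms k \<and> matching_of k p = M.
      ?T (matching_of k p) (reversed_edges k p))"
  proof (rule sum.cong[OF refl])
    fix M assume "M \<in> perfect_matchings (2 * k)"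
    have "(\<Sum>p | p \<in> sorted_perms k \<and> matching_of k p = M.
        ?T (matching_of k p) (reversed_edges k p)) =
      (\<Sum>p | p \<in> sorted_perms k \<and> matching_of k p = M. ?T M (reversed_edges k p))"
      by (rule sum.cong) auto
    also have "\<dots> = (\<Sum>R\<in>Pow M. ?T M R)"
      by (rule sum.reindex_bij_betw[OF bij_betw_reversed_edges]) fact
    finally show "(\<Sum>R\<in>Pow M. ?T M R) = (\<Sum>p | p \<in> sorted_perms k \<and> matching_of k p = M.
        ?T (matching_of k p) (reversed_edges k p))"
      by (rule sym)
  qed
  also have "\<dots> = (\<Sum>p\<in>sorted_perms k. ?T (matching_of k p) (reversed_edges k p))"
    by (rule sum.group[OF fin finite_perfect_matchings img])
  also have "\<dots> = (\<Sum>p\<in>sorted_perms k. (- 1) ^ (k choose 2) *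
      (of_int (sign p) * (\<Prod>r<k. Z (p r) (p (k + r)))))"
    by (intro sum.cong refl signed_prod_edges[symmetric]) (simp add: sorted_perms_def)
  finally show ?thesis by (simp only: sum_distrib_left)
qed

section \<open>Determinants of submatrices and the Pfaffian formula\<close>

lemma prod_lessThan_double:
  fixes f :: "nat \<Rightarrow> 'a :: comm_monoid_mult"
  shows "prod f {..<2 * k} = (\<Prod>r<k. f r * f (k + r))"
proof -
  have "prod f {..<k + m} = prod f {..<k} * (\<Prod>r<m. f (k + r))" for m
    by (induction m) (simp_all add: mult_ac)
  from this[of k] show ?thesis
    by (simp add: mult_2 prod.distrib)
qed

lemma det_submatrix:
  fixes X :: "'a :: comm_ring_1 mat"
  assumes X: "X \<in> carrier_mat n n"
    and I: "I \<subseteq> {0..<n}" "card I = k" and J: "J \<subseteq> {0..<n}" "card J = k"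
  shows "det (submatrix X I J) =
    (\<Sum>\<sigma> | \<sigma> permutes {0..<k}. of_int (sign \<sigma>) * (\<Prod>r<k. X $$ (pick I r, pick J (\<sigma> r))))"
proof -
  have dims: "card {i. i < dim_row X \<and> i \<in> I} = k" "card {j. j < dim_col X \<and> j \<in> J} = k"
  proof -
    have "{i. i < dim_row X \<and> i \<in> I} = I" "{j. j < dim_col X \<and> j \<in> J} = J"
      using X I J by auto
    then show "card {i. i < dim_row X \<and> i \<in> I} = k" "card {j. j < dim_col X \<and> j \<in> J} = k"
      using I J by simp_all
  qed
  have "submatrix X I J \<in> carrier_mat k k"
    by (rule carrier_matI) (simp_all only: dim_submatrix dims)
  then have "det (submatrix X I J) = (\<Sum>\<sigma> | \<sigma> permutes {0..<k}.
      of_int (sign \<sigma>) * (\<Prod>r = 0..<k. submatrix X I J $$ (r, \<sigma> r)))"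
    by (rule det_def')
  also have "\<dots> = (\<Sum>\<sigma> | \<sigma> permutes {0..<k}.
      of_int (sign \<sigma>) * (\<Prod>r<k. X $$ (pick I r, pick J (\<sigma> r))))"
  proof (rule sum.cong[OF refl])
    fix \<sigma> assume "\<sigma> \<in> {\<sigma>. \<sigma> permutes {0..<k}}"
    then have "\<sigma> r < k" if "r < k" for r
      using permutes_in_image[of \<sigma> "{0..<k}" r] that by simp
    then have "submatrix X I J $$ (r, \<sigma> r) = X $$ (pick I r, pick J (\<sigma> r))" if "r < k" for r
      using that by (intro submatrix_index) (simp_all only: dims)
    then show "of_int (sign \<sigma>) * (\<Prod>r = 0..<k. submatrix X I J $$ (r, \<sigma> r)) =
        of_int (sign \<sigma>) * (\<Prod>r<k. X $$ (pick I r, pick J (\<sigma> r)))"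
      by (simp add: atLeast0LessThan)
  qed
  finally show ?thesis .
qed

lemma cols_submatrix_carrier:
  assumes "A \<in> carrier_mat m n" "I \<subseteq> {0..<n}" "card I = k"
  shows "cols_submatrix A I \<in> carrier_mat m k"
    and "i < m \<Longrightarrow> j < k \<Longrightarrow> cols_submatrix A I $$ (i, j) = A $$ (i, pick I j)"
proof -
  have dims: "card {i. i < dim_row A \<and> i \<in> UNIV} = m" "card {j. j < dim_col A \<and> j \<in> I} = k"
  proof -
    have "{i. i < dim_row A \<and> i \<in> UNIV} = {..<m}" "{j. j < dim_col A \<and> j \<in> I} = I"
      using assms by auto
    then show "card {i. i < dim_row A \<and> i \<in> UNIV} = m" "card {j. j < dim_col A \<and> j \<in> I} = k"
      using assms by simp_all
  qed
  show "cols_submatrix A I \<in> carrier_mat m k"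
    unfolding cols_submatrix_def carrier_mat_def using dims by (simp add: dim_submatrix)
  show "cols_submatrix A I $$ (i, j) = A $$ (i, pick I j)" if "i < m" "j < k"
    unfolding cols_submatrix_def using that dims by (subst submatrix_index) (simp_all add: pick_UNIV)
qed

text \<open>The Leibniz formula for \<open>A\<^sup>I B\<^sup>J\<close>, expanded along columns and with columns \<open>r\<close> and \<open>k + r\<close> paired; column \<open>r\<close>
  then plays the part of the tail and column \<open>k + r\<close> that of the head of edge \<open>r\<close>.\<close>

lemma det_append_cols_submatrix:
  fixes A B :: "'a :: comm_ring_1 mat"
  assumes A: "A \<in> carrier_mat (2 * k) n" and B: "B \<in> carrier_mat (2 * k) n"
    and I: "I \<subseteq> {0..<n}" "card I = k" and J: "J \<subseteq> {0..<n}" "card J = k"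
  shows "det (cols_submatrix A I @\<^sub>c cols_submatrix B J) =
    (\<Sum>p | p permutes {0..<2 * k}. of_int (sign p) *
      (\<Prod>r<k. A $$ (p r, pick I r) * B $$ (p (k + r), pick J r)))"
proof -
  let ?C = "cols_submatrix A I @\<^sub>c cols_submatrix B J"
  note AI = cols_submatrix_carrier[OF A I] and BJ = cols_submatrix_carrier[OF B J]
  have dims: "dim_row (cols_submatrix A I) = 2 * k" "dim_col (cols_submatrix A I) = k"
    "dim_row (cols_submatrix B J) = 2 * k" "dim_col (cols_submatrix B J) = k"
    using AI(1) BJ(1) by auto
  have C: "?C \<in> carrier_mat (2 * k) (2 * k)"
    using four_block_carrier_mat[OF AI(1) zero_carrier_mat[of 0 k]]
    by (simp add: append_cols_def dims mult_2)
  have index: "?C $$ (i, r) = A $$ (i, pick I r)" "?C $$ (i, k + r) = B $$ (i, pick J r)"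
    if "i < 2 * k" "r < k" for i r
    using that AI(2) BJ(2) by (simp_all add: append_cols_def dims)
  have "det ?C = (\<Sum>p | p permutes {0..<2 * k}. of_int (sign p) * (\<Prod>j<2 * k. ?C $$ (p j, j)))"
    using C by (rule det_col)
  also have "\<dots> = (\<Sum>p | p permutes {0..<2 * k}. of_int (sign p) *
      (\<Prod>r<k. A $$ (p r, pick I r) * B $$ (p (k + r), pick J r)))"
  proof (rule sum.cong[OF refl])
    fix p assume "p \<in> {p. p permutes {0..<2 * k}}"
    then have "p i < 2 * k" if "i < 2 * k" for i
      using permutes_in_image[of p "{0..<2 * k}" i] that by simp
    then show "of_int (sign p) * (\<Prod>j<2 * k. ?C $$ (p j, j)) = of_int (sign p) *
        (\<Prod>r<k. A $$ (p r, pick I r) * B $$ (p (k + r), pick J r))"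
      by (simp add: prod_lessThan_double index)
  qed
  finally show ?thesis .
qed

text \<open>The bracketing \<open>A (X B\<^sup>t)\<close> displays \<open>Z = A X B\<^sup>t\<close> as a sum over the columns of \<open>A\<close>, the form in
  which it is expanded first.\<close>

lemma skew_product_index:
  fixes A B X :: "'a :: comm_ring_1 mat"
  assumes A: "A \<in> carrier_mat m n" and B: "B \<in> carrier_mat m n" and X: "X \<in> carrier_mat n n"
    and ij: "i < m" "j < m"
  defines "Z \<equiv> \<lambda>i j. \<Sum>c = 0..<n. A $$ (i, c) * (\<Sum>d = 0..<n. X $$ (c, d) * B $$ (j, d))"
  shows "(A * X * transpose_mat B - B * transpose_mat X * transpose_mat A) $$ (i, j) = Z i j - Z j i"
proof -
  have 1: "(A * X * transpose_mat B) $$ (i, j) = Z i j"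
    using A B X ij by (simp add: scalar_prod_def Z_def)
  have "(B * transpose_mat X * transpose_mat A) $$ (i, j) =
      (\<Sum>d = 0..<n. B $$ (i, d) * (\<Sum>c = 0..<n. X $$ (c, d) * A $$ (j, c)))"
    using A B X ij by (simp add: scalar_prod_def)
  also have "\<dots> = Z j i"
    unfolding Z_def sum_distrib_left by (subst sum.swap) (simp add: mult_ac)
  finally have "(B * transpose_mat X * transpose_mat A) $$ (i, j) = Z j i" .
  with 1 show ?thesis
    using A B X ij by simp
qed

theorem theorem4:
  fixes A B X :: "'a :: comm_ring_1 mat" and m n :: nat
  assumes "m > 0" and "n > 0" and "even m"
    and "A \<in> carrier_mat m n" and "B \<in> carrier_mat m n" and "X \<in> carrier_mat n n"
  shows "pfaffian (A * X * transpose_mat B - B * transpose_mat X * transpose_mat A) =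
    (- 1) ^ ((m div 2) choose 2) *
    (\<Sum>I\<in>{I. I \<subseteq> {0..<n} \<and> card I = m div 2}. \<Sum>J\<in>{J. J \<subseteq> {0..<n} \<and> card J = m div 2}.
      det (submatrix X I J) * det (cols_submatrix A I @\<^sub>c cols_submatrix B J))"
proof -
  define k where "k = m div 2"
  have m: "m = 2 * k" using \<open>even m\<close> by (simp add: k_def)
  note A = assms(4)[unfolded m] and B = assms(5)[unfolded m] and X = assms(6)
  let ?Y = "A * X * transpose_mat B - B * transpose_mat X * transpose_mat A"
  define V where "V j c = (\<Sum>d = 0..<n. X $$ (c, d) * B $$ (j, d))" for j c
  define Z where "Z i j = (\<Sum>c = 0..<n. A $$ (i, c) * V j c)" for i j
  let ?sets = "{I. I \<subseteq> {0..<n} \<and> card I = k}"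
  have "pfaffian ?Y = (\<Sum>M\<in>perfect_matchings (2 * k). (- 1) ^ crossings M *
      (\<Prod>e\<in>M. Z (Min e) (Max e) - Z (Max e) (Min e)))"
  proof -
    have "?Y $$ (Min e, Max e) = Z (Min e) (Max e) - Z (Max e) (Min e)"
      if M: "M \<in> perfect_matchings (2 * k)" "e \<in> M" for M e
    proof -
      have "Min e < 2 * k" "Max e < 2 * k"
        using perfect_matchings_edge(3,5)[OF M] by simp_all
      then show ?thesis
        unfolding Z_def V_def by (rule skew_product_index[OF A B X])
    qed
    moreover have "dim_row ?Y = 2 * k" using A B by simp
    ultimately show ?thesis by (simp add: pfaffian_def)
  qed
  also have "\<dots> = (- 1) ^ (k choose 2) *
      (\<Sum>p\<in>sorted_perms k. of_int (sign p) * (\<Prod>r<k. Z (p r) (p (k + r))))"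
    by (rule pfaffian_skew_part)
  also have "(\<Sum>p\<in>sorted_perms k. of_int (sign p) * (\<Prod>r<k. Z (p r) (p (k + r)))) =
      (\<Sum>I\<in>?sets. \<Sum>q | q permutes {0..<2 * k}.
        of_int (sign q) * (\<Prod>r<k. A $$ (q r, pick I r) * V (q (k + r)) (pick I r)))"
    unfolding Z_def by (rule sum_sorted_perms_cauchy_binet)
  also have "\<dots> = (\<Sum>I\<in>?sets. \<Sum>J\<in>?sets.
      det (submatrix X I J) * det (cols_submatrix A I @\<^sub>c cols_submatrix B J))"
  proof (rule sum.cong[OF refl])
    fix I assume I: "I \<in> ?sets"
    have "(\<Sum>q | q permutes {0..<2 * k}.
        of_int (sign q) * (\<Prod>r<k. A $$ (q r, pick I r) * V (q (k + r)) (pick I r))) =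
      (\<Sum>J\<in>?sets.
        (\<Sum>\<sigma> | \<sigma> permutes {0..<k}. of_int (sign \<sigma>) * (\<Prod>r<k. X $$ (pick I r, pick J (\<sigma> r)))) *
        (\<Sum>p | p permutes {0..<2 * k}. of_int (sign p) *
          (\<Prod>r<k. A $$ (p r, pick I r) * B $$ (p (k + r), pick J r))))"
      unfolding V_def by (rule sum_perms_cauchy_binet)
    also have "\<dots> = (\<Sum>J\<in>?sets.
        det (submatrix X I J) * det (cols_submatrix A I @\<^sub>c cols_submatrix B J))"
      using I by (intro sum.cong refl) (auto simp: det_submatrix[OF X] det_append_cols_submatrix[OF A B])
    finally show "(\<Sum>q | q permutes {0..<2 * k}.
        of_int (sign q) * (\<Prod>r<k. A $$ (q r, pick I r) * V (q (k + r)) (pick I r))) =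
      (\<Sum>J\<in>?sets. det (submatrix X I J) * det (cols_submatrix A I @\<^sub>c cols_submatrix B J))" .
  qed
  finally show ?thesis unfolding k_def .
qed

end
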